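(* There exists $\varepsilon_3 > 0$ such that $$c_{-2} < \frac{1}{2\sqrt{2}} - \varepsilon_3,$$ where $c_{-2} = \sup\{|\lambda_{n-1}(G)|/n : G \text{ a graph with } |V(G)| = n \ge 3\}$.
   Context: Graphs are finite, simple and undirected. For a graph $G$ on $n \ge 3$ vertices, $\lambda_1(G) \ge \lambda_2(G) \ge \dots \ge \lambda_n(G)$ denote the eigenvalues (with multiplicity) of its adjacency matrix. The supremum is over all orders $n \ge 3$ and all graphs of order $n$. *)

theory Defs
  imports
    Complex_Main
    "HOL-Computational_Algebra.Polynomial"
    "Graph_Theory.Pair_Digraph"
    "Jordan_Normal_Form.Char_Poly"
begin

text \<open>
  Finite simple undirected graphs are given by the locale \<open>pair_graph\<close>: a finite vertex set with
  an irreflexive symmetric relation on it.  Vertices are listed in increasing order to obtain the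
  adjacency matrix; the choice of order does not affect the spectrum.
\<close>

definition adjacency_matrix :: "'a::linorder pair_pre_digraph \<Rightarrow> real mat" where
  "adjacency_matrix G =
     (let vs = sorted_list_of_set (pverts G); n = card (pverts G)
      in mat n n (\<lambda>(i, j). if (vs ! i, vs ! j) \<in> parcs G then 1 else 0))"

text \<open>
  The real roots of the characteristic polynomial with multiplicity, in decreasing order.  For a
  graph the adjacency matrix is real symmetric, so all eigenvalues are real and the list has length
  \<open>card (pverts G)\<close>.
\<close>

definition eigenvalue_list :: "'a::linorder pair_pre_digraph \<Rightarrow> real list" where
  "eigenvalue_list G = rev (sorted_list_of_multiset (proots (char_poly (adjacency_matrix G))))"

text \<open>The index \<open>k\<close> starts at 1.\<close>

definition graph_eigenvalue :: "nat \<Rightarrow> 'a::linorder pair_pre_digraph \<Rightarrow> real" where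
  "graph_eigenvalue k G = eigenvalue_list G ! (k - 1)"

text \<open>
  Vertices are natural numbers, which covers every finite graph up to isomorphism.  As
  \<open>\<bar>\<lambda>\<^sub>i\<bar> < n\<close> for every eigenvalue \<open>\<lambda>\<^sub>i\<close> of a graph of order \<open>n\<close>, the set is bounded
  and the real-valued supremum is the true one.
\<close>

definition c_minus_2 :: real where
  "c_minus_2 =
     Sup {\<bar>graph_eigenvalue (n - 1) G\<bar> / real n | (n::nat) (G :: nat pair_pre_digraph).
            n \<ge> 3 \<and> pair_graph G \<and> card (pverts G) = n}"

end

theory Submission
  imports Defs "Jordan_Normal_Form.Schur_Decomposition" "HOL-Analysis.Convex"
begin

text \<open>
  Let \<open>A\<close> be the adjacency matrix of a graph of order \<open>n\<close>, let \<open>l \<le> m\<close> be its two smallest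
  eigenvalues and \<open>f\<close>, \<open>g\<close> orthonormal eigenvectors for them.  Everything is read off the
  \<open>\<plusminus>1\<close> matrix \<open>S = J - 2 A\<close>, where \<open>J\<close> is the all-ones matrix.  Its Frobenius norm is \<open>n\<close>, and
  \<open>\<langle>S f, f\<rangle> \<ge> - 2 l\<close>, \<open>\<langle>S g, g\<rangle> \<ge> - 2 m\<close>, because \<open>J\<close> is positive semidefinite.  By the
  Cauchy-Schwarz inequality this gives the classical bound \<open>m \<ge> - n / (2 \<surd>2)\<close>.

  If \<open>m\<close> is close to this bound, then \<open>S\<close> is close in Frobenius norm to
  \<open>r (f f\<^sup>T + g g\<^sup>T)\<close> with \<open>r = n / \<surd>2\<close>.  The entries of the latter are the inner
  products \<open>t\<^sub>i\<^sub>j\<close> of \<open>n\<close> vectors in the plane, and such inner products cannot nearly all be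
  \<open>\<plusminus>1\<close>: if all vectors had length \<open>2\<^sup>1\<^sup>/\<^sup>4\<close>, all angles between them would have to be near odd
  multiples of \<open>\<pi> / 4\<close>, whereas a positive proportion of pairs of directions in the plane is
  nearly parallel.  Quantitatively, \<open>\<Sum> t\<^sup>2 = n\<^sup>2\<close>, whereas
  \<open>\<Sum> t\<^sup>4 \<ge> 3 / 2 n\<^sup>2\<close> (lemma \<open>sum_fourth_powers_gram_ge\<close>), so
  \<open>\<Sum> (t\<^sup>2 - 1)\<^sup>2 \<ge> n\<^sup>2 / 2\<close>.  The eigenvalue equation bounds the entries of \<open>f\<close> and \<open>g\<close>
  by a constant times \<open>1 / \<surd>n\<close>, hence the \<open>t\<^sub>i\<^sub>j\<close> by a constant, so \<open>(t\<^sup>2 - 1)\<^sup>2\<close> is at most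
  a constant times \<open>(t - S\<^sub>i\<^sub>j)\<^sup>2\<close>, and \<open>S\<close> stays far from the rank two matrix.
  This is lemma \<open>second_eigenvalue_gap\<close>; it gives an explicit gap independent of \<open>n\<close>, so
  that it survives the supremum.

  The case \<open>m > 0\<close> is separate because of the absolute value: then all
  eigenvalues but \<open>l\<close> are at least \<open>m\<close>, the trace is \<open>0\<close> and \<open>l \<ge> - n / 2\<close>, hence
  \<open>m \<le> n / (2 (n - 1)) \<le> n / 4\<close>.

  The eigenvalues are given as the roots of the characteristic polynomial.  For a symmetric
  real matrix this polynomial splits over the reals, and triangularising the matrix with the
  two smallest roots in front turns these roots into two orthonormal eigenvectors, also when
  they coincide (lemma \<open>two_orthonormal_eigenvectors\<close>).
\<close>

section \<open>Gram matrices of vectors in the plane\<close>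

lemma bessel_two:
  fixes v f g :: "nat \<Rightarrow> real"
  assumes ff: "(\<Sum>j<n. (f j)\<^sup>2) = 1" and gg: "(\<Sum>j<n. (g j)\<^sup>2) = 1"
    and fg: "(\<Sum>j<n. f j * g j) = 0"
  shows "(\<Sum>j<n. v j * f j)\<^sup>2 + (\<Sum>j<n. v j * g j)\<^sup>2 \<le> (\<Sum>j<n. (v j)\<^sup>2)"
proof -
  define \<alpha> where "\<alpha> = (\<Sum>j<n. v j * f j)"
  define \<beta> where "\<beta> = (\<Sum>j<n. v j * g j)"
  have "0 \<le> (\<Sum>j<n. (v j - \<alpha> * f j - \<beta> * g j)\<^sup>2)"
    by (intro sum_nonneg) auto
  also have "\<dots>
      = (\<Sum>j<n. (v j)\<^sup>2 + \<alpha>\<^sup>2 * (f j)\<^sup>2 + \<beta>\<^sup>2 * (g j)\<^sup>2 - 2 * \<alpha> * (v j * f j)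
                 - 2 * \<beta> * (v j * g j) + 2 * \<alpha> * \<beta> * (f j * g j))"
    by (rule sum.cong) (auto simp: power2_eq_square algebra_simps)
  also have "\<dots> = (\<Sum>j<n. (v j)\<^sup>2) + \<alpha>\<^sup>2 + \<beta>\<^sup>2 - 2 * \<alpha> * \<alpha> - 2 * \<beta> * \<beta>"
    unfolding sum.distrib sum_subtractf sum_distrib_left[symmetric] ff gg fg
    by (simp add: \<alpha>_def \<beta>_def)
  finally have "(\<Sum>j<n. (v j)\<^sup>2) + \<alpha>\<^sup>2 + \<beta>\<^sup>2 - 2 * \<alpha> * \<alpha> - 2 * \<beta> * \<beta> \<ge> 0" .
  then show ?thesis
    by (simp add: \<alpha>_def \<beta>_def power2_eq_square)
qed

text \<open>
  The vectors are \<open>v\<^sub>i = (f i, g i)\<close> in the plane.  The left-hand side is the squared norm of the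
  symmetric tensor \<open>\<Sum> v\<^sub>i\<^sup>\<otimes>\<^sup>4\<close>, whose components are the mixed moments of order four.  Its
  rotation invariant part is a multiple of \<open>\<Sum> \<bar>v\<^sub>i\<bar>\<^sup>4\<close>, and this sum is at least
  \<open>(\<Sum> \<bar>v\<^sub>i\<bar>\<^sup>2)\<^sup>2 / n\<close>.  The factor \<open>3 / 8\<close> in the proof is the mean of \<open>cos\<^sup>4\<close> over the circle.
\<close>

lemma sum_fourth_powers_gram_ge:
  fixes f g :: "nat \<Rightarrow> real"
  assumes n: "n > 0"
    and ff: "(\<Sum>j<n. (f j)\<^sup>2) = 1" and gg: "(\<Sum>j<n. (g j)\<^sup>2) = 1"
  shows "(\<Sum>i<n. \<Sum>j<n. (f i * f j + g i * g j) ^ 4) \<ge> 6 / (real n)\<^sup>2"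
proof -
  define M where "M a b = (\<Sum>i<n. f i ^ a * g i ^ b)" for a b :: nat
  have MM: "(\<Sum>i<n. \<Sum>j<n. (f i ^ a * g i ^ b) * (f j ^ a * g j ^ b)) = (M a b)\<^sup>2" for a b
    by (simp add: M_def power2_eq_square sum_product)
  have const: "(\<Sum>i<n. \<Sum>j<n. c * F i j) = c * (\<Sum>i<n. \<Sum>j<n. F i j)"
    for c :: real and F :: "nat \<Rightarrow> nat \<Rightarrow> real"
    by (simp add: sum_distrib_left)
  have "(\<Sum>i<n. \<Sum>j<n. (f i * f j + g i * g j) ^ 4)
      = (\<Sum>i<n. \<Sum>j<n. (f i ^ 4 * g i ^ 0) * (f j ^ 4 * g j ^ 0)
           + 4 * ((f i ^ 3 * g i ^ 1) * (f j ^ 3 * g j ^ 1))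
           + 6 * ((f i ^ 2 * g i ^ 2) * (f j ^ 2 * g j ^ 2))
           + 4 * ((f i ^ 1 * g i ^ 3) * (f j ^ 1 * g j ^ 3))
           + (f i ^ 0 * g i ^ 4) * (f j ^ 0 * g j ^ 4))"
    by (intro sum.cong refl) (simp add: power2_eq_square power3_eq_cube power4_eq_xxxx algebra_simps)
  also have "\<dots> = (M 4 0)\<^sup>2 + 4 * (M 3 1)\<^sup>2 + 6 * (M 2 2)\<^sup>2 + 4 * (M 1 3)\<^sup>2 + (M 0 4)\<^sup>2"
    unfolding sum.distrib const MM ..
  finally have "(\<Sum>i<n. \<Sum>j<n. (f i * f j + g i * g j) ^ 4)
      \<ge> (M 4 0)\<^sup>2 + 6 * (M 2 2)\<^sup>2 + (M 0 4)\<^sup>2" by simp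
  \<comment> \<open>Cauchy-Schwarz for the weights \<open>1, 6, 1\<close>, written as a sum of squares: equality holds
      for \<open>M 4 0 = 3 * M 2 2 = M 0 4\<close>, the moments of the uniform distribution on a circle.\<close>
  moreover have "(M 4 0)\<^sup>2 + 6 * (M 2 2)\<^sup>2 + (M 0 4)\<^sup>2 - 3 / 8 * (M 4 0 + 2 * M 2 2 + M 0 4)\<^sup>2
      = 3 / 8 * (M 4 0 - M 0 4)\<^sup>2 + 1 / 4 * (M 4 0 - 3 * M 2 2)\<^sup>2
        + 1 / 4 * (M 0 4 - 3 * M 2 2)\<^sup>2" (is "_ = ?r")
    by (simp add: power2_eq_square algebra_simps)
  moreover have "?r \<ge> 0" by simp
  ultimately have 1: "(\<Sum>i<n. \<Sum>j<n. (f i * f j + g i * g j) ^ 4)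
      \<ge> 3 / 8 * (M 4 0 + 2 * M 2 2 + M 0 4)\<^sup>2" by linarith
  have "M 4 0 + 2 * M 2 2 + M 0 4 = (\<Sum>i<n. ((f i)\<^sup>2 + (g i)\<^sup>2)\<^sup>2)"
    unfolding M_def sum_distrib_left sum.distrib[symmetric]
    by (intro sum.cong refl) (simp add: power2_eq_square power4_eq_xxxx algebra_simps)
  also have "\<dots> \<ge> (\<Sum>i<n. (f i)\<^sup>2 + (g i)\<^sup>2)\<^sup>2 / n"
    using sum_squared_le_sum_of_squares[of "\<lambda>i. (f i)\<^sup>2 + (g i)\<^sup>2" "{..<n}"] n
    by (simp add: field_simps)
  also have "(\<Sum>i<n. (f i)\<^sup>2 + (g i)\<^sup>2)\<^sup>2 / n = 4 / n"
    by (simp add: sum.distrib ff gg)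
  finally have "(M 4 0 + 2 * M 2 2 + M 0 4)\<^sup>2 \<ge> (4 / n)\<^sup>2"
    by (intro power_mono) auto
  with 1 show ?thesis by (simp add: power_divide)
qed

lemma sum_squares_gram:
  fixes f g :: "nat \<Rightarrow> real"
  assumes ff: "(\<Sum>j<n. (f j)\<^sup>2) = 1" and gg: "(\<Sum>j<n. (g j)\<^sup>2) = 1"
    and fg: "(\<Sum>j<n. f j * g j) = 0"
  shows "(\<Sum>i<n. \<Sum>j<n. (f i * f j + g i * g j)\<^sup>2) = 2"
proof -
  have "(\<Sum>i<n. \<Sum>j<n. (f i * f j + g i * g j)\<^sup>2)
      = (\<Sum>i<n. \<Sum>j<n. (f i)\<^sup>2 * (f j)\<^sup>2 + 2 * ((f i * g i) * (f j * g j)) + (g i)\<^sup>2 * (g j)\<^sup>2)"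
    by (intro sum.cong refl) (simp add: power2_eq_square algebra_simps)
  also have "\<dots> = 2"
    unfolding sum.distrib sum_distrib_left[symmetric] sum_product[symmetric] ff gg fg
    by (simp add: ff gg)
  finally show ?thesis .
qed

section \<open>The gap for the two smallest eigenvalues\<close>

text \<open>
  The all-ones part of the form contributes \<open>(\<Sum> f)\<^sup>2\<close>, which is nonnegative and is dropped.
\<close>

lemma signed_adjacency_form:
  fixes a :: "nat \<Rightarrow> nat \<Rightarrow> real"
  assumes ff: "(\<Sum>j<n. (f j)\<^sup>2) = 1"
    and ev: "\<And>i. i < n \<Longrightarrow> (\<Sum>j<n. a i j * f j) = l * f i"
  shows "(\<Sum>i<n. \<Sum>j<n. (1 - 2 * a i j) * (f i * f j)) \<ge> - 2 * l"
proof -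
  have "(\<Sum>i<n. \<Sum>j<n. (1 - 2 * a i j) * (f i * f j))
      = (\<Sum>i<n. \<Sum>j<n. f i * f j) - 2 * (\<Sum>i<n. f i * (\<Sum>j<n. a i j * f j))"
    by (simp add: algebra_simps sum_subtractf sum_distrib_left)
  also have "(\<Sum>i<n. f i * (\<Sum>j<n. a i j * f j)) = (\<Sum>i<n. l * (f i)\<^sup>2)"
    by (intro sum.cong refl) (simp add: ev power2_eq_square)
  also have "\<dots> = l" by (simp add: sum_distrib_left[symmetric] ff)
  also have "(\<Sum>i<n. \<Sum>j<n. f i * f j) = (\<Sum>i<n. f i)\<^sup>2"
    by (simp add: power2_eq_square sum_product)
  finally show ?thesis by simp
qed

text \<open>
  A \<open>\<plusminus>1\<close> matrix has Frobenius norm \<open>n\<close>, which bounds its quadratic form on unit vectors; the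
  bound is obtained by expanding the squared distance of the matrix from \<open>n f f\<^sup>T\<close>.
\<close>

lemma eigenvalue_ge_minus_half_order:
  fixes a :: "nat \<Rightarrow> nat \<Rightarrow> real"
  assumes n: "n > 0" and a01: "\<And>i j. i < n \<Longrightarrow> j < n \<Longrightarrow> a i j \<in> {0, 1}"
    and ff: "(\<Sum>j<n. (f j)\<^sup>2) = 1"
    and ev: "\<And>i. i < n \<Longrightarrow> (\<Sum>j<n. a i j * f j) = l * f i"
  shows "l \<ge> - real n / 2"
proof -
  let ?s = "\<lambda>i j. 1 - 2 * a i j"
  have "0 \<le> (\<Sum>i<n. \<Sum>j<n. (?s i j - n * (f i * f j))\<^sup>2)" by (intro sum_nonneg) auto
  also have "\<dots> = (\<Sum>i<n. \<Sum>j<n. 1 - 2 * n * (?s i j * (f i * f j))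
                     + (real n)\<^sup>2 * ((f i)\<^sup>2 * (f j)\<^sup>2))"
  proof (intro sum.cong refl)
    fix i j assume "i \<in> {..<n}" "j \<in> {..<n}"
    then have "a i j = 0 \<or> a i j = 1" using a01[of i j] by auto
    then show "(?s i j - n * (f i * f j))\<^sup>2
        = 1 - 2 * n * (?s i j * (f i * f j)) + (real n)\<^sup>2 * ((f i)\<^sup>2 * (f j)\<^sup>2)"
      by (auto simp: power2_eq_square algebra_simps)
  qed
  also have "\<dots> = real n * real n - 2 * n * (\<Sum>i<n. \<Sum>j<n. ?s i j * (f i * f j)) + (real n)\<^sup>2"
    unfolding sum.distrib sum_subtractf sum_distrib_left[symmetric] sum_product[symmetric] ff
    by (simp add: ff)
  finally have "2 * n * (\<Sum>i<n. \<Sum>j<n. ?s i j * (f i * f j)) \<le> 2 * n * real n"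
    by (simp add: power2_eq_square)
  then have "(\<Sum>i<n. \<Sum>j<n. ?s i j * (f i * f j)) \<le> real n"
    using n by simp
  with signed_adjacency_form[OF ff ev] show ?thesis by force
qed

text \<open>
  With \<open>s\<close> for the \<open>\<plusminus>1\<close> matrix and \<open>r q\<close> for its candidate approximation of rank two, the squared
  distance is bounded above by \<open>2 n\<^sup>2 + 8 r m\<close>, which vanishes for \<open>m = - n / (2 \<surd>2)\<close>, and below by
  \<open>n\<^sup>2 / (2 * 13\<^sup>2)\<close> through the fourth moments if \<open>m \<le> - n / 4\<close>; the \<open>13\<close> is \<open>16 / \<surd>2 + 1\<close>,
  rounded up.  The two bounds are incompatible as soon as
  \<open>1 / 2 > 13\<^sup>2 * 4 \<surd>2 * \<delta>\<close> for the gap \<open>\<delta>\<close>; \<open>\<delta> = 1 / 2000\<close> satisfies this.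
\<close>

lemma second_eigenvalue_gap:
  fixes a :: "nat \<Rightarrow> nat \<Rightarrow> real"
  assumes n: "n > 0" and a01: "\<And>i j. i < n \<Longrightarrow> j < n \<Longrightarrow> a i j \<in> {0, 1}"
    and ff: "(\<Sum>j<n. (f j)\<^sup>2) = 1" and gg: "(\<Sum>j<n. (g j)\<^sup>2) = 1"
    and fg: "(\<Sum>j<n. f j * g j) = 0"
    and evf: "\<And>i. i < n \<Longrightarrow> (\<Sum>j<n. a i j * f j) = l * f i"
    and evg: "\<And>i. i < n \<Longrightarrow> (\<Sum>j<n. a i j * g j) = m * g i"
    and lm: "l \<le> m"
  shows "m \<ge> - (1 / (2 * sqrt 2) - 1 / 2000) * n"
proof (rule ccontr)
  assume "\<not> ?thesis"
  then have m: "m < - (1 / (2 * sqrt 2) - 1 / 2000) * n" by simp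
  define s where "s i j = 1 - 2 * a i j" for i j
  define q where "q i j = f i * f j + g i * g j" for i j
  define r where "r = n / sqrt 2"
  have r2: "r\<^sup>2 = (real n)\<^sup>2 / 2" and r4: "r ^ 4 = (real n) ^ 4 / 4"
    and r0: "r > 0"
    using n by (simp_all add: r_def power_divide power4_eq_xxxx)
  have sqrt2: "sqrt 2 \<ge> 1.414" "sqrt 2 \<le> 1.4143"
    by (rule real_le_rsqrt, simp add: power2_eq_square) (rule real_le_lsqrt, auto simp: power2_eq_square)
  have s1: "(s i j)\<^sup>2 = 1" "\<bar>s i j\<bar> = 1" if "i < n" "j < n" for i j
    using a01[OF that] by (auto simp: s_def)
  have q2: "(\<Sum>i<n. \<Sum>j<n. (q i j)\<^sup>2) = 2"
    unfolding q_def by (rule sum_squares_gram[OF ff gg fg])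
  have upper: "(\<Sum>i<n. \<Sum>j<n. (s i j - r * q i j)\<^sup>2) \<le> 2 * (real n)\<^sup>2 + 8 * r * m"
  proof -
    have "(\<Sum>i<n. \<Sum>j<n. (s i j - r * q i j)\<^sup>2)
        = (\<Sum>i<n. \<Sum>j<n. 1 - 2 * r * (s i j * q i j) + r\<^sup>2 * (q i j)\<^sup>2)"
      by (intro sum.cong refl) (simp add: power2_diff power_mult_distrib s1)
    also have "\<dots> = 2 * (real n)\<^sup>2 - 2 * r * (\<Sum>i<n. \<Sum>j<n. s i j * q i j)"
      unfolding sum.distrib sum_subtractf sum_distrib_left[symmetric] q2 r2
      by (simp add: power2_eq_square)
    also have "(\<Sum>i<n. \<Sum>j<n. s i j * q i j)
        = (\<Sum>i<n. \<Sum>j<n. s i j * (f i * f j)) + (\<Sum>i<n. \<Sum>j<n. s i j * (g i * g j))"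
      by (simp add: q_def algebra_simps sum.distrib)
    finally have "(\<Sum>i<n. \<Sum>j<n. (s i j - r * q i j)\<^sup>2) = 2 * (real n)\<^sup>2
        - 2 * r * ((\<Sum>i<n. \<Sum>j<n. s i j * (f i * f j)) + (\<Sum>i<n. \<Sum>j<n. s i j * (g i * g j)))" .
    moreover have "(\<Sum>i<n. \<Sum>j<n. s i j * (f i * f j)) + (\<Sum>i<n. \<Sum>j<n. s i j * (g i * g j)) \<ge> - 4 * m"
      using signed_adjacency_form[OF ff evf] signed_adjacency_form[OF gg evg] lm
      unfolding s_def by linarith
    then have "2 * r * ((\<Sum>i<n. \<Sum>j<n. s i j * (f i * f j)) + (\<Sum>i<n. \<Sum>j<n. s i j * (g i * g j)))
        \<ge> 2 * r * (- 4 * m)"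
      using r0 by (intro mult_left_mono) auto
    ultimately show ?thesis by linarith
  qed
  have "8 * r * m < 8 * r * (- (1 / (2 * sqrt 2) - 1 / 2000) * n)"
    using m r0 by (intro mult_strict_left_mono) auto
  also have "\<dots> = - 2 * (real n)\<^sup>2 + 4 * sqrt 2 / 2000 * (real n)\<^sup>2"
  proof -
    have r: "r = n * sqrt 2 / 2" and c: "1 / (2 * sqrt 2) = sqrt 2 / 4"
      by (simp_all add: r_def field_simps)
    have "sqrt 2 * (sqrt 2 * x) = 2 * x" for x
      using real_sqrt_mult_self[of 2] by (simp flip: mult.assoc)
    then show ?thesis unfolding r c by (simp add: algebra_simps power2_eq_square)
  qed
  finally have upper': "(\<Sum>i<n. \<Sum>j<n. (s i j - r * q i j)\<^sup>2) \<le> 4 * sqrt 2 / 2000 * (real n)\<^sup>2"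
    using upper by linarith
  have m4: "m \<le> - n / 4"
  proof -
    have "1 / (2 * sqrt 2) - 1 / 2000 \<ge> 1 / 4" using sqrt2 by (simp add: field_simps)
    then have "(1 / (2 * sqrt 2) - 1 / 2000) * n \<ge> 1 / 4 * n" by (intro mult_right_mono) auto
    with m show ?thesis unfolding mult_minus_left by linarith
  qed
  \<comment> \<open>Bessel's inequality for the rows of the matrix: delocalisation of the eigenvectors.\<close>
  have bound: "(f i)\<^sup>2 + (g i)\<^sup>2 \<le> 16 / n" if i: "i < n" for i
  proof -
    have "(l * f i)\<^sup>2 + (m * g i)\<^sup>2 \<le> (\<Sum>j<n. (a i j)\<^sup>2)"
      using bessel_two[OF ff gg fg, of "a i"] evf[OF i] evg[OF i] by simp
    also have "\<dots> \<le> (\<Sum>j<n. 1)" using a01[OF i] by (intro sum_mono) fastforce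
    finally have 1: "l\<^sup>2 * (f i)\<^sup>2 + m\<^sup>2 * (g i)\<^sup>2 \<le> n" by (simp add: power_mult_distrib)
    have "l\<^sup>2 \<ge> (n / 4)\<^sup>2" "m\<^sup>2 \<ge> (n / 4)\<^sup>2"
      using m4 lm by (auto intro!: abs_le_square_iff[THEN iffD1])
    then have "(n / 4)\<^sup>2 * (f i)\<^sup>2 + (n / 4)\<^sup>2 * (g i)\<^sup>2 \<le> n"
      using 1 by (smt (verit) mult_right_mono zero_le_power2)
    then have "(f i)\<^sup>2 + (g i)\<^sup>2 \<le> n / (n / 4)\<^sup>2"
      using n by (subst pos_le_divide_eq) (auto simp: algebra_simps)
    also have "\<dots> = 16 / n" by (simp add: power2_eq_square)
    finally show ?thesis .
  qed
  have qb: "\<bar>r * q i j\<bar> \<le> 12" if "i < n" "j < n" for i j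
  proof -
    have "\<bar>q i j\<bar> \<le> ((f i)\<^sup>2 + (g i)\<^sup>2 + ((f j)\<^sup>2 + (g j)\<^sup>2)) / 2"
    proof -
      have "0 \<le> (f i - f j)\<^sup>2" "0 \<le> (g i - g j)\<^sup>2" "0 \<le> (f i + f j)\<^sup>2" "0 \<le> (g i + g j)\<^sup>2" by auto
      then show ?thesis unfolding q_def power2_sum power2_diff by argo
    qed
    also have "\<dots> \<le> 16 / n" using bound[OF that(1)] bound[OF that(2)] by simp
    finally have "r * \<bar>q i j\<bar> \<le> r * (16 / n)" using r0 by (intro mult_left_mono) auto
    also have "\<dots> \<le> 12" using n sqrt2 by (simp add: r_def field_simps)
    finally show ?thesis using r0 by (simp add: abs_mult)
  qed
  have "(real n)\<^sup>2 / 2 \<le> r ^ 4 * (6 / (real n)\<^sup>2) - 2 * r\<^sup>2 * 2 + real n * real n"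
    unfolding r2 r4 using n by (simp add: field_simps power2_eq_square power4_eq_xxxx)
  also have "\<dots> \<le> r ^ 4 * (\<Sum>i<n. \<Sum>j<n. q i j ^ 4) - 2 * r\<^sup>2 * (\<Sum>i<n. \<Sum>j<n. (q i j)\<^sup>2) + real n * real n"
    unfolding q2 using sum_fourth_powers_gram_ge[OF n ff gg, folded q_def]
    by (intro add_right_mono diff_right_mono mult_left_mono) auto
  also have "\<dots> = (\<Sum>i<n. \<Sum>j<n. r ^ 4 * q i j ^ 4 - 2 * r\<^sup>2 * (q i j)\<^sup>2 + 1)"
    unfolding sum.distrib sum_subtractf sum_distrib_left[symmetric] by simp
  also have "\<dots> \<le> (\<Sum>i<n. \<Sum>j<n. 169 * (s i j - r * q i j)\<^sup>2)"
  proof (intro sum_mono)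
    fix i j assume "i \<in> {..<n}" "j \<in> {..<n}"
    then have ij: "i < n" "j < n" by auto
    \<comment> \<open>Since \<open>s i j\<close> is a sign, \<open>(r q)\<^sup>2 - 1\<close> factors as \<open>(r q + s) (r q - s)\<close>.\<close>
    have "r ^ 4 * q i j ^ 4 - 2 * r\<^sup>2 * (q i j)\<^sup>2 + 1 = ((r * q i j)\<^sup>2 - (s i j)\<^sup>2)\<^sup>2"
      unfolding s1[OF ij] by (simp add: power2_eq_square power4_eq_xxxx algebra_simps)
    also have "\<dots> = (s i j + r * q i j)\<^sup>2 * (s i j - r * q i j)\<^sup>2"
      by (simp add: power2_eq_square algebra_simps)
    also have "(s i j + r * q i j)\<^sup>2 \<le> 13\<^sup>2"
      using qb[OF ij] s1(2)[OF ij] by (intro abs_le_square_iff[THEN iffD1]) linarith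
    finally show "r ^ 4 * q i j ^ 4 - 2 * r\<^sup>2 * (q i j)\<^sup>2 + 1 \<le> 169 * (s i j - r * q i j)\<^sup>2"
      by (simp add: mult_right_mono)
  qed
  also have "\<dots> \<le> 169 * (4 * sqrt 2 / 2000 * (real n)\<^sup>2)"
    using upper' by (simp add: sum_distrib_left[symmetric])
  finally have "(real n)\<^sup>2 * (1 / 2 - 169 * (4 * sqrt 2 / 2000)) \<le> 0" by (simp add: algebra_simps)
  moreover have "1 / 2 - 169 * (4 * sqrt 2 / 2000) > 0" using sqrt2 by simp
  ultimately show False using n by (simp add: mult_le_0_iff)
qed

section \<open>Spectral theory of symmetric real matrices\<close>

lemma mult_mat_vec_index_sum:
  assumes "A \<in> carrier_mat n n" "v \<in> carrier_vec n" "i < n"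
  shows "(A *\<^sub>v v) $ i = (\<Sum>j<n. A $$ (i, j) * v $ j)"
  using assms by (simp add: scalar_prod_def lessThan_atLeast0)

lemma mult_mat_index_sum:
  assumes "A \<in> carrier_mat n n" "B \<in> carrier_mat n n" "i < n" "k < n"
  shows "(A * B) $$ (i, k) = (\<Sum>j<n. A $$ (i, j) * B $$ (j, k))"
  using assms by (simp add: scalar_prod_def lessThan_atLeast0)

text \<open>
  For an eigenvector \<open>v\<close> the number \<open>v\<^sup>* A v\<close> is its own conjugate and equals \<open>k\<close> times the positive
  real number \<open>v\<^sup>* v\<close>.
\<close>

lemma symmetric_real_eigenvalue_real:
  fixes A :: "real mat"
  assumes A: "A \<in> carrier_mat n n"
    and sym: "\<And>i j. i < n \<Longrightarrow> j < n \<Longrightarrow> A $$ (i, j) = A $$ (j, i)"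
    and ev: "eigenvalue (map_mat complex_of_real A) k"
  shows "k \<in> \<real>"
proof -
  let ?A = "map_mat complex_of_real A"
  have A': "?A \<in> carrier_mat n n" using A by simp
  from ev obtain v where v: "v \<in> carrier_vec n" "v \<noteq> 0\<^sub>v n" "?A *\<^sub>v v = k \<cdot>\<^sub>v v"
    using A unfolding eigenvalue_def eigenvector_def by auto
  have row: "(\<Sum>j<n. of_real (A $$ (i, j)) * v $ j) = k * v $ i" if "i < n" for i
  proof -
    have "(?A *\<^sub>v v) $ i = k * v $ i" using v that by simp
    moreover have "(\<Sum>j<n. ?A $$ (i, j) * v $ j) = (\<Sum>j<n. of_real (A $$ (i, j)) * v $ j)"
      using A that by (intro sum.cong) auto
    ultimately show ?thesis by (simp only: mult_mat_vec_index_sum[OF A' v(1) that])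
  qed
  define S where "S = (\<Sum>i<n. \<Sum>j<n. of_real (A $$ (i, j)) * (v $ j * cnj (v $ i)))"
  define N where "N = (\<Sum>i<n. (cmod (v $ i))\<^sup>2)"
  have "S = (\<Sum>i<n. (\<Sum>j<n. of_real (A $$ (i, j)) * v $ j) * cnj (v $ i))"
    by (simp add: S_def sum_distrib_right mult.assoc)
  also have "\<dots> = (\<Sum>i<n. k * of_real ((cmod (v $ i))\<^sup>2))"
    by (intro sum.cong refl) (simp only: lessThan_iff row complex_norm_square mult.assoc)
  finally have S: "S = k * of_real N" by (simp add: N_def sum_distrib_left)
  have "cnj S = (\<Sum>i<n. \<Sum>j<n. of_real (A $$ (i, j)) * (v $ i * cnj (v $ j)))"
    by (simp add: S_def mult_ac)
  also have "\<dots> = (\<Sum>j<n. \<Sum>i<n. of_real (A $$ (j, i)) * (v $ i * cnj (v $ j)))"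
    by (subst sum.swap) (auto intro!: sum.cong simp: sym)
  also have "\<dots> = S" by (simp add: S_def)
  finally have "S \<in> \<real>" by (simp add: Reals_cnj_iff)
  moreover have "N \<noteq> 0"
  proof
    assume "N = 0"
    then have "\<forall>i<n. v $ i = 0" unfolding N_def by (subst (asm) sum_nonneg_eq_0_iff) auto
    then have "v = 0\<^sub>v n" using v(1) by (intro eq_vecI) auto
    with v(2) show False by simp
  qed
  ultimately show ?thesis
    using S by (metis Reals_divide Reals_of_real nonzero_mult_div_cancel_right of_real_eq_0_iff)
qed

lemma char_poly_symmetric_splits:
  fixes A :: "real mat"
  assumes A: "A \<in> carrier_mat n n"
    and sym: "\<And>i j. i < n \<Longrightarrow> j < n \<Longrightarrow> A $$ (i, j) = A $$ (j, i)"
  shows "\<exists>es. char_poly A = (\<Prod>e\<leftarrow>es. [:- e, 1:]) \<and> length es = n"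
proof -
  interpret ph: map_poly_inj_comm_ring_hom complex_of_real ..
  let ?A = "map_mat complex_of_real A"
  have A': "?A \<in> carrier_mat n n" using A by simp
  from char_poly_factorized[OF A'] obtain as
    where as: "char_poly ?A = (\<Prod>a\<leftarrow>as. [:- a, 1:])" and len: "length as = n" by blast
  have real: "a \<in> \<real>" if "a \<in> set as" for a
  proof (rule symmetric_real_eigenvalue_real[OF A sym])
    have "poly (char_poly ?A) a = 0"
      unfolding as using that by (auto simp: poly_prod_list prod_list_zero_iff image_iff o_def)
    then show "eigenvalue ?A a" by (simp add: eigenvalue_root_char_poly[OF A'])
  qed auto
  define es where "es = map Re as"
  have as_es: "as = map complex_of_real es"
    unfolding es_def using real by (auto simp: map_idI[symmetric] o_def intro!: map_idI[symmetric])
  have "map_poly complex_of_real (char_poly A) = char_poly ?A"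
    by (rule of_real_hom.char_poly_hom[OF A, symmetric])
  also have "\<dots> = map_poly complex_of_real (\<Prod>e\<leftarrow>es. [:- e, 1:])"
    unfolding as as_es by (simp add: ph.hom_prod_list o_def)
  finally have "char_poly A = (\<Prod>e\<leftarrow>es. [:- e, 1:])" by (rule ph.injectivity)
  then show ?thesis using len by (intro exI[of _ es]) (simp add: es_def)
qed

lemma proots_linear_factors:
  "proots (\<Prod>e\<leftarrow>es. [:- e, 1 :: 'a :: idom:]) = mset es"
proof (induction es)
  case (Cons e es)
  have "(\<Prod>e\<leftarrow>es. [:- e, 1 :: 'a:]) \<noteq> 0" by (auto simp: prod_list_zero_iff)
  then have "proots ([:- e, 1:] * (\<Prod>e\<leftarrow>es. [:- e, 1 :: 'a:])) = {#e#} + mset es"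
    by (subst proots_mult) (auto simp: Cons.IH)
  then show ?case by simp
qed simp

lemma trace_mult_commute:
  fixes X Y :: "'a :: comm_ring_1 mat"
  assumes "X \<in> carrier_mat n n" "Y \<in> carrier_mat n n"
  shows "(\<Sum>i<n. (X * Y) $$ (i, i)) = (\<Sum>i<n. (Y * X) $$ (i, i))"
proof -
  have "(\<Sum>i<n. (X * Y) $$ (i, i)) = (\<Sum>i<n. \<Sum>j<n. X $$ (i, j) * Y $$ (j, i))"
    using assms by (intro sum.cong) (auto simp: mult_mat_index_sum simp del: index_mult_mat)
  also have "\<dots> = (\<Sum>j<n. \<Sum>i<n. Y $$ (j, i) * X $$ (i, j))"
    by (subst sum.swap) (simp add: mult.commute)
  also have "\<dots> = (\<Sum>i<n. (Y * X) $$ (i, i))"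
    using assms by (intro sum.cong) (auto simp: mult_mat_index_sum simp del: index_mult_mat)
  finally show ?thesis .
qed

text \<open>
  The trace is invariant under similarity, and a triangular matrix similar to \<open>A\<close> has the roots on
  its diagonal.
\<close>

lemma trace_eq_sum_roots:
  fixes A :: "real mat"
  assumes A: "A \<in> carrier_mat n n" and cp: "char_poly A = (\<Prod>e\<leftarrow>es. [:- e, 1:])"
  shows "(\<Sum>i<n. A $$ (i, i)) = sum_list es"
proof -
  obtain B P Q where BPQ: "schur_decomposition A es = (B, P, Q)" by (cases "schur_decomposition A es")
  from schur_decomposition[OF A cp BPQ]
  have wit: "similar_mat_wit A B P Q" and diag: "diag_mat B = es" by auto
  note w = similar_mat_witD2[OF A wit]
  have "(\<Sum>i<n. A $$ (i, i)) = (\<Sum>i<n. (P * (B * Q)) $$ (i, i))"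
    by (simp only: w(3) assoc_mult_mat[OF w(6) w(5) w(7)])
  also have "\<dots> = (\<Sum>i<n. (B * Q * P) $$ (i, i))"
    by (rule trace_mult_commute[OF w(6) mult_carrier_mat[OF w(5) w(7)]])
  also have "B * Q * P = B" by (simp only: assoc_mult_mat[OF w(5) w(7) w(6)] w(2) right_mult_one_mat[OF w(5)])
  also have "(\<Sum>i<n. B $$ (i, i)) = sum_list (diag_mat B)"
    using w(5) by (simp add: diag_mat_def sum_list_distinct_conv_sum_set lessThan_atLeast0)
  finally show ?thesis by (simp add: diag)
qed

text \<open>
  The Schur form \<open>B = P\<^sup>-\<^sup>1 A P\<close> can be given any order of the roots on its diagonal.  Its first two
  columns say that the first column \<open>u\<close> of \<open>P\<close> is an eigenvector for \<open>l\<close> and that the second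
  column \<open>v\<close> satisfies \<open>A v = m v + b u\<close>.  The component \<open>h\<close> of \<open>v\<close> orthogonal to \<open>u\<close> then
  satisfies \<open>A h = m h + d u\<close>, and symmetry of \<open>A\<close> forces \<open>d = 0\<close>, as it makes \<open>A h\<close> orthogonal
  to \<open>u\<close>.  This covers a double root, for which two independent eigenvectors are needed.
\<close>

lemma two_orthonormal_eigenvectors:
  fixes A :: "real mat"
  assumes A: "A \<in> carrier_mat n n"
    and sym: "\<And>i j. i < n \<Longrightarrow> j < n \<Longrightarrow> A $$ (i, j) = A $$ (j, i)"
    and cp: "char_poly A = (\<Prod>e\<leftarrow>l # m # es. [:- e, 1:])"
  obtains f g :: "nat \<Rightarrow> real" where
    "(\<Sum>j<n. (f j)\<^sup>2) = 1" "(\<Sum>j<n. (g j)\<^sup>2) = 1" "(\<Sum>j<n. f j * g j) = 0"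
    "\<And>i. i < n \<Longrightarrow> (\<Sum>j<n. A $$ (i, j) * f j) = l * f i"
    "\<And>i. i < n \<Longrightarrow> (\<Sum>j<n. A $$ (i, j) * g j) = m * g i"
proof -
  obtain B P Q where BPQ: "schur_decomposition A (l # m # es) = (B, P, Q)"
    by (cases "schur_decomposition A (l # m # es)")
  from schur_decomposition[OF A cp BPQ]
  have wit: "similar_mat_wit A B P Q" and ut: "upper_triangular B" and diag: "diag_mat B = l # m # es"
    by auto
  note w = similar_mat_witD2[OF A wit]
  have n: "1 < n" "0 < n" using arg_cong[OF diag, of length] w(5) by (auto simp: diag_mat_def)
  have B: "B $$ (0, 0) = l" "B $$ (1, 1) = m"
    using arg_cong[OF diag, of "\<lambda>xs. xs ! 0"] arg_cong[OF diag, of "\<lambda>xs. xs ! 1"] w(5) n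
    by (auto simp: diag_mat_def)
  have Bz: "B $$ (k, j) = 0" if "j < k" "k < n" for j k
    using ut that w(5) by auto
  have PB: "P * B \<in> carrier_mat n n" using w by simp
  have "A * P = P * B * (Q * P)"
    by (subst (1) w(3)) (rule assoc_mult_mat[OF PB w(7) w(6)])
  then have AP: "A * P = P * B" by (simp only: w(2) right_mult_one_mat[OF PB])
  have APij: "(\<Sum>k<n. A $$ (i, k) * P $$ (k, j)) = (\<Sum>k<n. P $$ (i, k) * B $$ (k, j))"
    if "i < n" "j < n" for i j
    using arg_cong[OF AP, of "\<lambda>M. M $$ (i, j)"]
    by (simp only: mult_mat_index_sum[OF A w(6) that] mult_mat_index_sum[OF w(6) w(5) that])
  have QPij: "(\<Sum>k<n. Q $$ (i, k) * P $$ (k, j)) = (if i = j then 1 else 0)"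
    if "i < n" "j < n" for i j
    using arg_cong[OF w(2), of "\<lambda>M. M $$ (i, j)"] that
    by (simp only: mult_mat_index_sum[OF w(7) w(6) that] index_one_mat)
  define u where "u j = P $$ (j, 0)" for j
  define v where "v j = P $$ (j, 1)" for j
  define b where "b = B $$ (0, 1)"
  have Au: "(\<Sum>j<n. A $$ (i, j) * u j) = l * u i" if "i < n" for i
  proof -
    have "(\<Sum>k<n. P $$ (i, k) * B $$ (k, 0)) = (\<Sum>k\<in>{0}. P $$ (i, k) * B $$ (k, 0))"
      using n Bz by (intro sum.mono_neutral_right) auto
    then show ?thesis using APij[OF that n(2)] by (simp add: u_def B)
  qed
  have Av: "(\<Sum>j<n. A $$ (i, j) * v j) = b * u i + m * v i" if "i < n" for i
  proof -
    have "(\<Sum>k<n. P $$ (i, k) * B $$ (k, 1)) = (\<Sum>k\<in>{0, 1}. P $$ (i, k) * B $$ (k, 1))"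
      using n Bz by (intro sum.mono_neutral_right) auto
    then show ?thesis using APij[OF that n(1)] B(2) by (simp add: u_def v_def b_def)
  qed
  define c where "c = (\<Sum>j<n. u j * v j)"
  define U where "U = (\<Sum>j<n. (u j)\<^sup>2)"
  \<comment> \<open>\<open>P\<close> is invertible, so its first two columns are linearly independent.\<close>
  have U: "U > 0"
  proof -
    have "U \<noteq> 0"
    proof
      assume "U = 0"
      then have "\<forall>j<n. u j = 0" unfolding U_def by (subst (asm) sum_nonneg_eq_0_iff) auto
      with QPij[OF n(2) n(2)] show False by (simp add: u_def)
    qed
    moreover have "U \<ge> 0" unfolding U_def by (intro sum_nonneg) auto
    ultimately show ?thesis by simp
  qed
  define h where "h j = v j - c / U * u j" for j
  define H where "H = (\<Sum>j<n. (h j)\<^sup>2)"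
  have uh: "(\<Sum>j<n. u j * h j) = 0"
  proof -
    have "(\<Sum>j<n. u j * h j) = (\<Sum>j<n. u j * v j - c / U * (u j)\<^sup>2)"
      by (intro sum.cong refl) (simp add: h_def algebra_simps power2_eq_square)
    also have "\<dots> = c - c / U * U"
      unfolding sum_subtractf sum_distrib_left[symmetric] c_def U_def ..
    finally have "(\<Sum>j<n. u j * h j) = c - c / U * U" .
    then show ?thesis using U by simp
  qed
  have H: "H > 0"
  proof -
    have "H \<noteq> 0"
    proof
      assume "H = 0"
      then have "\<forall>j<n. h j = 0" unfolding H_def by (subst (asm) sum_nonneg_eq_0_iff) auto
      then have "(\<Sum>k<n. Q $$ (1, k) * v k) = (\<Sum>k<n. c / U * (Q $$ (1, k) * u k))"
        by (intro sum.cong) (auto simp: h_def)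
      also have "\<dots> = c / U * (\<Sum>k<n. Q $$ (1, k) * u k)"
        by (simp only: sum_distrib_left)
      finally show False
        using QPij[OF n(1) n(1)] QPij[OF n(1) n(2)] by (simp add: u_def v_def)
    qed
    moreover have "H \<ge> 0" unfolding H_def by (intro sum_nonneg) auto
    ultimately show ?thesis by simp
  qed
  define d where "d = b + (m - l) * (c / U)"
  have Ah: "(\<Sum>j<n. A $$ (i, j) * h j) = d * u i + m * h i" if "i < n" for i
  proof -
    have "(\<Sum>j<n. A $$ (i, j) * h j) = (\<Sum>j<n. A $$ (i, j) * v j - c / U * (A $$ (i, j) * u j))"
      by (intro sum.cong refl) (simp add: h_def algebra_simps)
    also have "\<dots> = (\<Sum>j<n. A $$ (i, j) * v j) - c / U * (\<Sum>j<n. A $$ (i, j) * u j)"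
      by (simp only: sum_subtractf sum_distrib_left)
    also have "\<dots> = d * u i + m * h i"
      unfolding Au[OF that] Av[OF that] by (simp add: h_def d_def algebra_simps diff_divide_distrib)
    finally show ?thesis .
  qed
  have "d = 0"
  proof -
    have "(\<Sum>i<n. u i * (\<Sum>j<n. A $$ (i, j) * h j)) = (\<Sum>i<n. d * (u i)\<^sup>2 + m * (u i * h i))"
      by (intro sum.cong refl) (simp add: Ah power2_eq_square distrib_left)
    also have "\<dots> = d * U"
      unfolding sum.distrib sum_distrib_left[symmetric] uh U_def by simp
    finally have "d * U = (\<Sum>i<n. \<Sum>j<n. A $$ (i, j) * (u i * h j))"
      by (simp add: sum_distrib_left mult_ac)
    also have "\<dots> = (\<Sum>j<n. \<Sum>i<n. A $$ (j, i) * (u i * h j))"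
      by (subst sum.swap) (auto intro!: sum.cong simp: sym)
    also have "\<dots> = (\<Sum>j<n. (\<Sum>i<n. A $$ (j, i) * u i) * h j)"
      by (simp add: sum_distrib_right mult.assoc)
    also have "\<dots> = (\<Sum>j<n. l * (u j * h j))"
      by (intro sum.cong refl) (simp add: Au)
    also have "\<dots> = 0" unfolding sum_distrib_left[symmetric] uh by simp
    finally show ?thesis using U by simp
  qed
  define f where "f j = u j / sqrt U" for j
  define g where "g j = h j / sqrt H" for j
  show thesis
  proof (rule that[of f g])
    show "(\<Sum>j<n. (f j)\<^sup>2) = 1" "(\<Sum>j<n. (g j)\<^sup>2) = 1"
      using U H by (simp_all add: f_def g_def power_divide flip: sum_divide_distrib U_def H_def)
    show "(\<Sum>j<n. f j * g j) = 0"
      using uh by (simp add: f_def g_def flip: sum_divide_distrib)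
    show "(\<Sum>j<n. A $$ (i, j) * f j) = l * f i" if "i < n" for i
      using Au[OF that] by (simp add: f_def flip: sum_divide_distrib)
    show "(\<Sum>j<n. A $$ (i, j) * g j) = m * g i" if "i < n" for i
      using Ah[OF that] \<open>d = 0\<close> by (simp add: g_def flip: sum_divide_distrib)
  qed
qed

section \<open>Eigenvalues of graphs\<close>

lemma adjacency_matrix_simple_graph:
  fixes G :: "'a::linorder pair_pre_digraph"
  assumes G: "pair_graph G" and n: "card (pverts G) = n"
  shows "adjacency_matrix G \<in> carrier_mat n n"
    and "\<And>i j. i < n \<Longrightarrow> j < n \<Longrightarrow> adjacency_matrix G $$ (i, j) \<in> {0, 1}"
    and "\<And>i j. i < n \<Longrightarrow> j < n \<Longrightarrow> adjacency_matrix G $$ (i, j) = adjacency_matrix G $$ (j, i)"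
    and "\<And>i. i < n \<Longrightarrow> adjacency_matrix G $$ (i, i) = 0"
proof -
  interpret pair_graph G by fact
  let ?vs = "sorted_list_of_set (pverts G)"
  have entry: "adjacency_matrix G $$ (i, j) = (if (?vs ! i, ?vs ! j) \<in> parcs G then 1 else 0)"
    if "i < n" "j < n" for i j
    using that n by (simp add: adjacency_matrix_def Let_def)
  have sym: "(v, u) \<in> parcs G" if "(u, v) \<in> parcs G" for u v
    using pair_sym_arcs that by (auto simp: symmetric_def dest: symD)
  show "adjacency_matrix G \<in> carrier_mat n n"
    by (simp add: adjacency_matrix_def Let_def n)
  show "adjacency_matrix G $$ (i, j) \<in> {0, 1}" if "i < n" "j < n" for i j
    using that by (simp add: entry)
  show "adjacency_matrix G $$ (i, j) = adjacency_matrix G $$ (j, i)" if "i < n" "j < n" for i j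
    using that by (auto simp: entry intro: sym)
  show "adjacency_matrix G $$ (i, i) = 0" if "i < n" for i
    using that by (auto simp: entry dest: pair_no_loops)
qed

lemma eigenvalue_list_simple_graph:
  fixes G :: "'a::linorder pair_pre_digraph"
  assumes G: "pair_graph G" and n: "card (pverts G) = n"
  obtains es where "sorted es" "length es = n" "eigenvalue_list G = rev es"
    "char_poly (adjacency_matrix G) = (\<Prod>e\<leftarrow>es. [:- e, 1:])"
proof -
  note A = adjacency_matrix_simple_graph[OF G n]
  obtain rs where rs: "char_poly (adjacency_matrix G) = (\<Prod>e\<leftarrow>rs. [:- e, 1:])" "length rs = n"
    using char_poly_symmetric_splits[OF A(1) A(3)] by blast
  have "mset (map (\<lambda>e. [:- e, 1:]) rs) = mset (map (\<lambda>e. [:- e, 1:]) (sort rs))"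
    by simp
  then have "(\<Prod>e\<leftarrow>rs. [:- e, 1:]) = (\<Prod>e\<leftarrow>sort rs. [:- e, 1:])"
    by (metis prod_mset_prod_list)
  then show thesis
    using rs by (intro that[of "sort rs"]) (simp_all add: eigenvalue_list_def proots_linear_factors)
qed

lemma second_smallest_graph_eigenvalue_bound:
  fixes G :: "'a::linorder pair_pre_digraph"
  assumes G: "pair_graph G" and card: "card (pverts G) = n" and n: "n \<ge> 3"
  shows "\<bar>graph_eigenvalue (n - 1) G\<bar> / real n \<le> 1 / (2 * sqrt 2) - 1 / 2000"
proof -
  let ?A = "adjacency_matrix G"
  note A = adjacency_matrix_simple_graph[OF G card]
  obtain es where es: "sorted es" "length es = n" "eigenvalue_list G = rev es"
    "char_poly ?A = (\<Prod>e\<leftarrow>es. [:- e, 1:])"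
    using eigenvalue_list_simple_graph[OF G card] .
  obtain l m es' where es_eq: "es = l # m # es'"
    using es(2) n by (metis Suc_le_length_iff numeral_3_eq_3)
  \<comment> \<open>Index \<open>n - 1\<close>, counted from 1 in decreasing order, is index 1, counted from 0, in
      increasing order.\<close>
  have "n - Suc (n - 1 - 1) = 1" using n by simp
  then have "rev es ! (n - 1 - 1) = es ! 1" using es(2) n by (subst rev_nth) auto
  then have ge: "graph_eigenvalue (n - 1) G = m"
    by (simp only: graph_eigenvalue_def es(3)) (simp add: es_eq)
  have lm: "l \<le> m" using es(1) es_eq by simp
  obtain f g where fg: "(\<Sum>j<n. (f j)\<^sup>2) = 1" "(\<Sum>j<n. (g j)\<^sup>2) = 1" "(\<Sum>j<n. f j * g j) = 0"
    "\<And>i. i < n \<Longrightarrow> (\<Sum>j<n. ?A $$ (i, j) * f j) = l * f i"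
    "\<And>i. i < n \<Longrightarrow> (\<Sum>j<n. ?A $$ (i, j) * g j) = m * g i"
    by (rule two_orthonormal_eigenvectors[OF A(1) _ es(4)[unfolded es_eq]]) ((rule A(3); assumption) | blast)+
  have n0: "n > 0" using n by simp
  have sqrt2: "sqrt 2 \<le> 1.4143" by (rule real_le_lsqrt) (auto simp: power2_eq_square)
  show ?thesis
  proof (cases "m \<le> 0")
    case True
    have "m \<ge> - (1 / (2 * sqrt 2) - 1 / 2000) * n"
      by (rule second_eigenvalue_gap[where a = "\<lambda>i j. ?A $$ (i, j)", OF n0 A(2) fg lm])
    then have "- m \<le> (1 / (2 * sqrt 2) - 1 / 2000) * n" unfolding mult_minus_left by linarith
    then show ?thesis using True n0 unfolding ge by (subst pos_divide_le_eq) auto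
  next
    case False
    \<comment> \<open>One negative eigenvalue has to balance all the others in the trace.\<close>
    have l: "l \<ge> - real n / 2"
      by (rule eigenvalue_ge_minus_half_order[where a = "\<lambda>i j. ?A $$ (i, j)", OF n0 A(2) fg(1,4)])
    have "real (length es') * m \<le> sum_list es'"
      using sum_list_mono[of es' "\<lambda>_. m" "\<lambda>x. x"] es(1) es_eq by (simp add: sum_list_triv)
    moreover have "l + m + sum_list es' = 0"
      using trace_eq_sum_roots[OF A(1) es(4)] A(4) es_eq by simp
    moreover have "real (length es') = real n - 2" using es(2) es_eq by auto
    ultimately have "(real n - 1) * m \<le> n / 2" using l by (simp add: algebra_simps)
    moreover have "2 * m \<le> (real n - 1) * m" using n False by (intro mult_right_mono) auto
    ultimately have "m / n \<le> 1 / 4" using n0 by (simp add: field_simps)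
    moreover have "1 / 4 \<le> 1 / (2 * sqrt 2) - 1 / 2000" using sqrt2 by (simp add: field_simps)
    ultimately have "m / n \<le> 1 / (2 * sqrt 2) - 1 / 2000" by linarith
    then show ?thesis unfolding ge using False by (simp only: abs_of_pos not_le)
  qed
qed

theorem corollary1p3:
  shows "\<exists>\<epsilon>\<^sub>3::real. \<epsilon>\<^sub>3 > 0 \<and> c_minus_2 < 1 / (2 * sqrt 2) - \<epsilon>\<^sub>3"
proof -
  have "c_minus_2 \<le> 1 / (2 * sqrt 2) - 1 / 2000"
    unfolding c_minus_2_def
  proof (rule cSup_least)
    let ?E = "\<lparr>pverts = {0, 1, 2 :: nat}, parcs = {}\<rparr>"
    have "pair_graph ?E"
      by unfold_locales (auto simp: symmetric_def with_proj_def arcs_ends_def sym_def)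
    moreover have "card (pverts ?E) = 3" by simp
    ultimately show "{\<bar>graph_eigenvalue (n - 1) G\<bar> / real n | (n::nat) (G :: nat pair_pre_digraph).
        n \<ge> 3 \<and> pair_graph G \<and> card (pverts G) = n} \<noteq> {}" by blast
  next
    fix x assume "x \<in> {\<bar>graph_eigenvalue (n - 1) G\<bar> / real n | (n::nat) (G :: nat pair_pre_digraph).
        n \<ge> 3 \<and> pair_graph G \<and> card (pverts G) = n}"
    then show "x \<le> 1 / (2 * sqrt 2) - 1 / 2000"
      using second_smallest_graph_eigenvalue_bound by blast
  qed
  then show ?thesis by (intro exI[of _ "1 / 4000"]) simp
qed

end
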